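(* Let $n,d\ge 1$, $e=(1,0,\dots,0)\in\mathbb{R}^{n+1}$, $\mathbf{x}=(x_1,\dots,x_n)$, and let $F\in\mathbb{R}[t,\mathbf{x}]$ be homogeneous of degree $d$ with $F(e)=1$. Let $\Delta_N(F)\in\mathbb{R}[s,\mathbf{x}]$ be the N-path discriminant of $F$. If $F$ is hyperbolic with respect to $e$, then $$\Delta_N(F)(s,a)\ge 0\quad\text{for all } s\in[0,1]\text{ and } a\in\mathbb{R}^n.$$ Conversely, if $\Delta_N(F)(s,a)>0$ for all $s\in[0,1]$ and all $a\in\mathbb{R}^n\setminus\{0\}$, then $F$ is strictly hyperbolic with respect to $e$.
   Context: Coordinates on $\mathbb{R}^{n+1}$ are $(t,x_1,\dots,x_n)$. A univariate real polynomial is real rooted if all its complex roots are real. A form (homogeneous polynomial) $F\in\mathbb{R}[t,\mathbf{x}]$ is hyperbolic with respect to $e$ if $F(e)\ne0$ and the univariate polynomial $F(ue-b)\in\mathbb{R}[u]$ is real rooted for all $b\in\mathbb{R}^{n+1}$; for $e=(1,0,\dots,0)$ and $F(e)=1$ this is equivalent to $F(t,a)\in\mathbb{R}[t]$ being real rooted for all $a\in\mathbb{R}^n$. It is strictly hyperbolic with respect to $e$ if $F(e)\neq 0$ and for all $b\in\mathbb{R}^{n+1}$, $b\neq0$, the roots of $F(ue-b)$ are real and distinct; for $e=(1,0,\dots,0)$ this is understood as: $F(t,a)\in\mathbb{R}[t]$ has real and distinct roots for all $a\in\mathbb{R}^n\setminus\{0\}$. Let $\mathcal{F}=\{F\in\mathbb{R}[t,\mathbf{x}]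 : F \text{ homogeneous of degree } d,\ F(e)=1\}$. For $s\in\mathbb{R}$ define operators on $\mathbb{R}[t,\mathbf{x}]$, mapping $\mathcal{F}$ to itself: $T^\ell_s(F)=F+s\,\ell\,\frac{\partial F}{\partial t}$ for a linear form $\ell\in\mathbb{R}[\mathbf{x}]$; $G_s(F)=F(t,s\mathbf{x})$; $H_s=(T^{x_1}_s)^d\cdots(T^{x_n}_s)^d$ (composition of operators, each $T^{x_i}_s$ applied $d$ times); $N_s=H_{1-s}G_s$ (first $G_s$, then $H_{1-s}$). For $F\in\mathcal{F}$, the N-path discriminant $\Delta_N(F)\in\mathbb{R}[s,\mathbf{x}]$ is the discriminant of $N_s(F)$ with respect to the variable $t$, with the usual normalization: the discriminant of a monic polynomial of degree $d$ with roots $\alpha_1,\dots,\alpha_d$ is $\prod_{i<j}(\alpha_i-\alpha_j)^2$. *)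

theory Defs
  imports
    "HOL-Library.Poly_Mapping"
    "Subresultants.Subresultant"
    "HOL-Computational_Algebra.Fundamental_Theorem_Algebra"
    Complex_Main
begin

section \<open>The polynomial rings \<open>A[x]\<close> and \<open>A[t,x]\<close>\<close>

text \<open>
  \<open>'a xpoly\<close> is the ring of polynomials over \<open>'a\<close> in indeterminates indexed by \<open>nat\<close>; the
  elements of \<open>A[x\<^sub>1,\<dots>,x\<^sub>n]\<close> are those all of whose monomials are supported in \<open>{1..n}\<close>.
  \<open>A[t,x]\<close> is \<open>A[x][t]\<close>: a polynomial in the univariate indeterminate \<open>t\<close> with coefficients
  in \<open>A[x]\<close>. A point \<open>(b\<^sub>0,b\<^sub>1,\<dots>,b\<^sub>n)\<close> is a function on \<open>nat\<close> of which only the values on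
  \<open>{0..n}\<close> are relevant; \<open>b 0\<close> is its \<open>t\<close>-coordinate. A point \<open>a\<close> of \<open>x\<close>-space likewise
  has the coordinates \<open>a 1,\<dots>,a n\<close>.
\<close>

type_synonym 'a xpoly = "(nat \<Rightarrow>\<^sub>0 nat) \<Rightarrow>\<^sub>0 'a"
type_synonym 'a txpoly = "'a xpoly poly"

definition xconst :: "'a::zero \<Rightarrow> 'a xpoly" where
  "xconst c = Poly_Mapping.single 0 c"

definition xvar :: "nat \<Rightarrow> 'a::zero_neq_one xpoly" where
  "xvar i = Poly_Mapping.single (Poly_Mapping.single i 1) 1"

text \<open>Apply \<open>h\<close> to the coefficients and substitute \<open>a i\<close> for \<open>x\<^sub>i\<close> (and \<open>a 0\<close> for \<open>t\<close>).\<close>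

definition xsubst :: "('a::zero \<Rightarrow> 'b::comm_semiring_1) \<Rightarrow> (nat \<Rightarrow> 'b) \<Rightarrow> 'a xpoly \<Rightarrow> 'b" where
  "xsubst h a p = (\<Sum>m\<in>Poly_Mapping.keys p.
     h (Poly_Mapping.lookup p m) * (\<Prod>i\<in>Poly_Mapping.keys m. a i ^ Poly_Mapping.lookup m i))"

definition txsubst :: "('a::zero \<Rightarrow> 'b::comm_semiring_1) \<Rightarrow> (nat \<Rightarrow> 'b) \<Rightarrow> 'a txpoly \<Rightarrow> 'b" where
  "txsubst h b F = poly (map_poly (xsubst h b) F) (b 0)"

definition txform :: "nat \<Rightarrow> nat \<Rightarrow> 'a::zero txpoly \<Rightarrow> bool" where
  "txform n d F \<longleftrightarrow> (\<forall>k. \<forall>m\<in>Poly_Mapping.keys (coeff F k).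
     Poly_Mapping.keys m \<subseteq> {1..n} \<and>
     k + (\<Sum>i\<in>Poly_Mapping.keys m. Poly_Mapping.lookup m i) = d)"

section \<open>Hyperbolicity\<close>

definition real_rooted :: "real poly \<Rightarrow> bool" where
  "real_rooted p \<longleftrightarrow> (\<forall>z. poly (map_poly complex_of_real p) z = 0 \<longrightarrow> z \<in> \<real>)"

definition real_distinct_rooted :: "real poly \<Rightarrow> bool" where
  "real_distinct_rooted p \<longleftrightarrow>
     (\<forall>z. poly (map_poly complex_of_real p) z = 0 \<longrightarrow>
        z \<in> \<real> \<and> order z (map_poly complex_of_real p) = 1)"

text \<open>The univariate polynomial \<open>F(u e - b)\<close> in \<open>u\<close>.\<close>

definition line_poly :: "real txpoly \<Rightarrow> (nat \<Rightarrow> real) \<Rightarrow> (nat \<Rightarrow> real) \<Rightarrow> real poly" where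
  "line_poly F e b = txsubst (\<lambda>c. [:c:]) (\<lambda>i. [:- b i, e i:]) F"

definition hyperbolic :: "real txpoly \<Rightarrow> (nat \<Rightarrow> real) \<Rightarrow> bool" where
  "hyperbolic F e \<longleftrightarrow> txsubst (\<lambda>c. c) e F \<noteq> 0 \<and> (\<forall>b. real_rooted (line_poly F e b))"

definition tdir :: "nat \<Rightarrow> real" where
  "tdir i = (if i = 0 then 1 else 0)"

text \<open>
  Strict hyperbolicity with respect to \<open>e = (1,0,\<dots>,0)\<close>: the roots of \<open>F(t,a)\<close> are real and
  distinct for all nonzero \<open>a\<close> in \<open>x\<close>-space. (Asking for distinct roots of \<open>F(u e - b)\<close> for
  all nonzero \<open>b\<close>, including the multiples of \<open>e\<close>, would be unsatisfiable in degree at least 2.)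
\<close>

definition strictly_hyperbolic_tdir :: "nat \<Rightarrow> real txpoly \<Rightarrow> bool" where
  "strictly_hyperbolic_tdir n F \<longleftrightarrow> txsubst (\<lambda>c. c) tdir F \<noteq> 0 \<and>
     (\<forall>a. (\<exists>i\<in>{1..n}. a i \<noteq> 0) \<longrightarrow> real_distinct_rooted (map_poly (xsubst (\<lambda>c. c) a) F))"

section \<open>The N-path\<close>

text \<open>
  The operators are defined over an arbitrary coefficient domain \<open>A\<close> with \<open>s \<in> A\<close>,
  so that \<open>s\<close> may be a real number or the indeterminate of \<open>\<real>[s]\<close>.
\<close>

definition T_op :: "'a::idom \<Rightarrow> 'a xpoly \<Rightarrow> 'a txpoly \<Rightarrow> 'a txpoly" where
  "T_op s l F = F + smult (xconst s * l) (pderiv F)"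

definition G_op :: "'a::idom \<Rightarrow> 'a txpoly \<Rightarrow> 'a txpoly" where
  "G_op s F = map_poly (xsubst xconst (\<lambda>i. xconst s * xvar i)) F"

definition H_op :: "nat \<Rightarrow> nat \<Rightarrow> 'a::idom \<Rightarrow> 'a txpoly \<Rightarrow> 'a txpoly" where
  "H_op n d s F = foldr (\<lambda>i. T_op s (xvar i) ^^ d) [1..<Suc n] F"

definition N_op :: "nat \<Rightarrow> nat \<Rightarrow> 'a::idom \<Rightarrow> 'a txpoly \<Rightarrow> 'a txpoly" where
  "N_op n d s F = H_op n d (1 - s) (G_op s F)"

text \<open>\<open>N\<^sub>s(F)\<close> with \<open>s\<close> the indeterminate \<open>[:0, 1:]\<close> of \<open>\<real>[s]\<close>, as an element of \<open>\<real>[s][x][t]\<close>.\<close>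

definition N_path :: "nat \<Rightarrow> nat \<Rightarrow> real txpoly \<Rightarrow> real poly txpoly" where
  "N_path n d F = N_op n d [:0, 1:] (map_poly (Poly_Mapping.map (\<lambda>c. [:c:])) F)"

section \<open>Discriminants\<close>

definition monic_discriminant :: "'a::idom poly \<Rightarrow> 'a" where
  "monic_discriminant p = (-1) ^ (degree p * (degree p - 1) div 2) * resultant p (pderiv p)"

text \<open>
  The normalization for monic polynomials is the usual one: the following lemmas culminate in the
  fact that the discriminant is the product of the squared differences of the roots.
\<close>

lemma root_product_swap:
  fixes f g :: "complex poly"
  assumes "f \<noteq> 0" "g \<noteq> 0"
  shows "lead_coeff f ^ degree g * (\<Prod>x\<in>#proots f. poly g x) =
    (-1) ^ (degree f * degree g) * (lead_coeff g ^ degree f * (\<Prod>y\<in>#proots g. poly f y))"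
proof -
  have ev: "poly p x = lead_coeff p * (\<Prod>y\<in>#proots p. x - y)" for p :: "complex poly" and x
    by (subst complex_poly_decompose_multiset[of p, symmetric])
      (simp add: poly_prod_mset image_mset.compositionality o_def algebra_simps)
  have full: "(\<Prod>x\<in>#proots f. poly g x) =
      lead_coeff g ^ degree f * (\<Prod>x\<in>#proots f. \<Prod>y\<in>#proots g. x - y)"
    if "f \<noteq> 0" for f g :: "complex poly"
    by (simp add: ev[of g] prod_mset.distrib size_proots_complex prod_mset_constant)
  have neg: "(\<Prod>x\<in>#proots f. \<Prod>y\<in>#proots g. x - y) =
      (-1) ^ (degree f * degree g) * (\<Prod>x\<in>#proots f. \<Prod>y\<in>#proots g. y - x)"
  proof -
    have "(\<Prod>y\<in>#A. x - y) = (-1) ^ size A * (\<Prod>y\<in>#A. y - x)" for A and x :: complex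
      by (induction A) (auto simp: algebra_simps)
    then have "(\<Prod>y\<in>#proots g. x - y) = (-1) ^ degree g * (\<Prod>y\<in>#proots g. y - x)" for x
      by (simp add: size_proots_complex)
    then show ?thesis
      by (simp add: prod_mset.distrib prod_mset_constant size_proots_complex power_mult mult.commute
          flip: power_mult)
  qed
  have sw: "(\<Prod>x\<in>#A. \<Prod>y\<in>#B. y - x) = (\<Prod>y\<in>#B. \<Prod>x\<in>#A. y - x)" for A B :: "complex multiset"
    by (rule prod_mset.swap)
  show ?thesis
    unfolding full[OF assms(1)] full[OF assms(2)] neg sw by simp
qed

lemma resultant_roots:
  fixes f g :: "complex poly"
  assumes "f \<noteq> 0" "g \<noteq> 0"
  shows "resultant f g = lead_coeff f ^ degree g * (\<Prod>x\<in>#proots f. poly g x)"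
proof -
  have main: "resultant f g = lead_coeff f ^ degree g * (\<Prod>x\<in>#proots f. poly g x)"
    if "f \<noteq> 0" "g \<noteq> 0" "degree g \<le> degree f" for f g :: "complex poly"
    using that
  proof (induction "degree g" arbitrary: f g rule: less_induct)
    case less
    define h where "h = f mod g"
    show ?case
    proof (cases "degree g = 0")
      case True
      then obtain c where "g = [:c:]" by (rule degree_eq_zeroE)
      moreover have "poly [:c:] = (\<lambda>_. c)" by auto
      ultimately show ?thesis by (simp add: prod_mset_constant size_proots_complex)
    next
      case dg: False
      have eq: "f + (- (f div g)) * g = h" unfolding h_def by (simp add: minus_div_mult_eq_mod)
      have hroot: "poly f y = poly h y" if "poly g y = 0" for y
        using arg_cong[OF eq, of "\<lambda>p. poly p y"] that by simp
      show ?thesis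
      proof (cases "h = 0")
        case True
        have "subresultant 0 f g = 0"
          using BT_eq_19[OF eq less.prems(3), of 0] dg True less.prems by simp
        then have "resultant f g = 0" by (simp add: subresultant_resultant)
        moreover obtain y where "poly g y = 0"
          using alg_closed_imp_poly_has_root[of g] dg by auto
        then have "poly f y = 0" using hroot True by simp
        with \<open>poly g y = 0\<close> have "(\<Prod>x\<in>#proots f. poly g x) = 0"
          using less.prems by (auto simp: image_iff) 
        ultimately show ?thesis by simp
      next
        case False
        have dh: "degree h < degree g"
          unfolding h_def using dg by (intro degree_mod_less') (use False h_def less.prems in auto)
        have IH: "resultant g h = lead_coeff g ^ degree h * (\<Prod>x\<in>#proots g. poly h x)"
          using less.hyps[OF dh, of g] False less.prems dh by simp
        have step: "resultant f g =
            (-1) ^ (degree f * degree g) * lead_coeff g ^ (degree f - degree h) * resultant g h"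
        proof (cases "degree h = 0")
          case True
          then obtain c where c: "h = [:c:]" by (rule degree_eq_zeroE)
          have "subresultant 0 f g = smult ((-1) ^ (degree f * degree g) *
              lead_coeff g ^ degree f * coeff h 0 ^ (degree g - 1)) h"
            using BT_eq_19[OF eq less.prems(3), of 0] dg dh True less.prems by simp
          then have "resultant f g = (-1) ^ (degree f * degree g) *
              lead_coeff g ^ degree f * c ^ (degree g - 1) * c"
            by (simp add: subresultant_resultant c)
          moreover have "c ^ (degree g - 1) * c = c ^ degree g"
            using dg by (cases "degree g") auto
          ultimately show ?thesis by (simp add: c mult.assoc)
        next
          case False
          have "subresultant 0 f g = smult ((-1) ^ (degree f * degree g) *
              lead_coeff g ^ (degree f - degree h)) (subresultant 0 g h)"
            using BT_lemma_1_12[OF eq less.prems(3), of 0] dg dh False less.prems by simp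
          then show ?thesis by (simp add: subresultant_resultant)
        qed
        have "(\<Prod>x\<in>#proots g. poly h x) = (\<Prod>x\<in>#proots g. poly f x)"
          using less.prems hroot by (intro arg_cong[of _ _ prod_mset] image_mset_cong) auto
        then have "resultant f g = (-1) ^ (degree f * degree g) *
            (lead_coeff g ^ (degree f - degree h) * lead_coeff g ^ degree h) * (\<Prod>x\<in>#proots g. poly f x)"
          unfolding step IH by simp
        also have "lead_coeff g ^ (degree f - degree h) * lead_coeff g ^ degree h = lead_coeff g ^ degree f"
          using dh less.prems by (simp flip: power_add)
        finally show ?thesis
          unfolding root_product_swap[OF less.prems(1,2)] by simp
      qed
    qed
  qed
  show ?thesis
  proof (cases "degree g \<le> degree f")
    case True
    then show ?thesis using main assms by blast
  next
    case False
    then show ?thesis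
      using main[OF assms(2,1)] resultant_swap[of f g] root_product_swap[OF assms] by simp
  qed
qed

lemma monic_discriminant_roots:
  fixes \<alpha> :: "nat \<Rightarrow> complex"
  shows "monic_discriminant (\<Prod>i<d. [:- \<alpha> i, 1:]) = (\<Prod>j<d. \<Prod>i<j. (\<alpha> i - \<alpha> j)\<^sup>2)"
proof (cases "d = 0")
  case True
  then show ?thesis by (simp add: monic_discriminant_def)
next
  case False
  define p where "p = (\<Prod>i<d. [:- \<alpha> i, 1:])"
  have deg: "degree p = d" unfolding p_def by (subst degree_prod_eq_sum_degree) auto
  have p0: "p \<noteq> 0" using deg False by auto
  have lc: "lead_coeff p = 1" unfolding p_def by (simp add: lead_coeff_prod)
  have p'0: "pderiv p \<noteq> 0" using deg False by (simp add: pderiv_eq_0_iff)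
  have roots: "proots p = image_mset \<alpha> (mset_set {..<d})"
  proof -
    have "proots [:- \<alpha> i, 1:] = {#\<alpha> i#}" for i
      using proots_linear_factor[of "- \<alpha> i"] by simp
    then have "proots p = (\<Sum>i<d. {#\<alpha> i#})"
      unfolding p_def by (subst proots_prod) (simp_all del: pCons_one)
    also have "\<dots> = image_mset \<alpha> (mset_set {..<d})"
      by (induction d) (auto simp: lessThan_Suc)
    finally show ?thesis .
  qed
  have p': "poly (pderiv p) (\<alpha> j) = (\<Prod>i\<in>{..<d} - {j}. \<alpha> j - \<alpha> i)" if "j < d" for j
  proof -
    have "p = [:- \<alpha> j, 1:] * (\<Prod>i\<in>{..<d} - {j}. [:- \<alpha> i, 1:])"
      unfolding p_def using that by (subst prod.remove[of _ j]) auto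
    then show ?thesis
      by (simp add: pderiv_mult pderiv_pCons poly_prod del: mult_pCons_left mult_pCons_right)
  qed
  have "resultant p (pderiv p) = (\<Prod>j<d. \<Prod>i\<in>{..<d} - {j}. \<alpha> j - \<alpha> i)"
    using resultant_roots[OF p0 p'0] lc p'
    by (simp add: roots image_mset.compositionality o_def flip: prod_unfold_prod_mset)
  also have "\<dots> = (-1) ^ (d * (d - 1) div 2) * (\<Prod>j<d. \<Prod>i<j. (\<alpha> i - \<alpha> j)\<^sup>2)"
  proof (induction d)
    case (Suc d)
    have "(\<Prod>j<Suc d. \<Prod>i\<in>{..<Suc d} - {j}. \<alpha> j - \<alpha> i) =
        (\<Prod>j<d. \<Prod>i\<in>{..<Suc d} - {j}. \<alpha> j - \<alpha> i) * (\<Prod>i<d. \<alpha> d - \<alpha> i)"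
      by (simp add: lessThan_Suc)
    also have "(\<Prod>j<d. \<Prod>i\<in>{..<Suc d} - {j}. \<alpha> j - \<alpha> i) =
        (\<Prod>j<d. (\<alpha> j - \<alpha> d) * (\<Prod>i\<in>{..<d} - {j}. \<alpha> j - \<alpha> i))"
      by (intro prod.cong refl) (simp add: lessThan_Suc insert_Diff_if)
    also have "\<dots> = (\<Prod>j<d. \<alpha> j - \<alpha> d) * (\<Prod>j<d. \<Prod>i\<in>{..<d} - {j}. \<alpha> j - \<alpha> i)"
      by (simp add: prod.distrib)
    also have "(\<Prod>i<d. \<alpha> d - \<alpha> i) = (-1) ^ d * (\<Prod>i<d. \<alpha> i - \<alpha> d)"
      using prod.distrib[of "\<lambda>_. - 1" "\<lambda>i. \<alpha> i - \<alpha> d" "{..<d}"] by simp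
    finally have "(\<Prod>j<Suc d. \<Prod>i\<in>{..<Suc d} - {j}. \<alpha> j - \<alpha> i) =
       (-1) ^ (d * (d - 1) div 2 + d) * ((\<Prod>j<d. \<Prod>i<j. (\<alpha> i - \<alpha> j)\<^sup>2) * (\<Prod>j<d. (\<alpha> j - \<alpha> d)\<^sup>2))"
      by (simp add: Suc.IH power_add prod.distrib power2_eq_square)
    moreover have "d * (d - 1) div 2 + d = Suc d * (Suc d - 1) div 2"
      by (cases d) auto
    ultimately show ?case by simp
  qed simp
  finally show ?thesis
    unfolding monic_discriminant_def p_def[symmetric] deg
    by (simp add: mult.assoc[symmetric] flip: power_add mult_2)
qed

definition N_discriminant :: "nat \<Rightarrow> nat \<Rightarrow> real txpoly \<Rightarrow> real poly xpoly" where
  "N_discriminant n d F = monic_discriminant (N_path n d F)"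

text \<open>The value at \<open>(s,a)\<close> of an element of \<open>\<real>[s,x] = \<real>[s][x]\<close>.\<close>

definition sx_eval :: "real poly xpoly \<Rightarrow> real \<Rightarrow> (nat \<Rightarrow> real) \<Rightarrow> real" where
  "sx_eval D s a = xsubst (\<lambda>c. poly c s) a D"

end

theory Submission
  imports Defs "HOL-Analysis.Topology_Euclidean_Space"
begin

text \<open>
  Evaluating the N-path at \<open>(s,a)\<close> gives the univariate polynomial obtained from \<open>F(t, s a)\<close> by
  applying each operator \<open>1 + (1 - s) a\<^sub>i d/dt\<close> \<open>d\<close> times. These operators preserve
  real-rootedness, and the discriminant of a real-rooted monic polynomial is nonnegative. For the
  converse fix \<open>a \<noteq> 0\<close>: at \<open>s = 0\<close> the path starts from \<open>t\<^sup>d\<close>, so it is real-rooted there. The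
  set of \<open>s \<in> [0,1]\<close> with a real-rooted polynomial is closed, because a monic \<open>p\<close> of degree \<open>d\<close>
  is real-rooted iff \<open>\<bar>Im z\<bar>\<^sup>d \<le> \<bar>p(z)\<bar>\<close> for all complex \<open>z\<close>. Its complement is closed as well,
  since two conjugate roots can only meet on the real axis in a multiple root. Hence the endpoint
  \<open>s = 1\<close>, which is \<open>F(t, a)\<close>, is real-rooted.
\<close>

section \<open>Substitution homomorphisms\<close>

text \<open>Updating at a key outside the support is adding a monomial, so additive statements
  reduce to monomials.\<close>

lemma poly_mapping_add_single_induct [case_names zero add_single]:
  assumes "P 0" and "\<And>p m c. P p \<Longrightarrow> P (p + Poly_Mapping.single m c)"
  shows "P p"
proof (induction p rule: update_induct)
  case (update p m c)
  have "Poly_Mapping.update m c p = p + Poly_Mapping.single m c"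
    using update.hyps
    by (intro poly_mapping_eqI) (auto simp: lookup_update lookup_add lookup_single when_def in_keys_iff)
  then show ?case using assms(2)[OF update.IH] by simp
qed (fact assms(1))

text \<open>Cancellation can make the support of a sum smaller than the union of the supports; a
  common index set allows termwise comparison.\<close>

lemma xsubst_eq_sum_superset:
  assumes "h 0 = 0" "finite K" "Poly_Mapping.keys p \<subseteq> K"
  shows "xsubst h a p = (\<Sum>m\<in>K. h (Poly_Mapping.lookup p m) *
    (\<Prod>i\<in>Poly_Mapping.keys m. a i ^ Poly_Mapping.lookup m i))"
  unfolding xsubst_def using assms
  by (intro sum.mono_neutral_left) (auto simp: in_keys_iff)

lemma xsubst_0 [simp]: "xsubst h a 0 = 0"
  by (simp add: xsubst_def)

lemma monomial_eval_add:
  fixes a :: "nat \<Rightarrow> 'b::comm_semiring_1"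
  shows "(\<Prod>i\<in>Poly_Mapping.keys (m + m'). a i ^ Poly_Mapping.lookup (m + m') i) =
    (\<Prod>i\<in>Poly_Mapping.keys m. a i ^ Poly_Mapping.lookup m i) *
    (\<Prod>i\<in>Poly_Mapping.keys m'. a i ^ Poly_Mapping.lookup m' i)"
proof -
  define K where "K = Poly_Mapping.keys m \<union> Poly_Mapping.keys m'"
  have eq: "(\<Prod>i\<in>Poly_Mapping.keys k. a i ^ Poly_Mapping.lookup k i) =
      (\<Prod>i\<in>K. a i ^ Poly_Mapping.lookup k i)" if "Poly_Mapping.keys k \<subseteq> K" for k
    using that unfolding K_def by (intro prod.mono_neutral_left) (auto simp: in_keys_iff)
  have "Poly_Mapping.keys (m + m') \<subseteq> K"
    unfolding K_def by (rule Poly_Mapping.keys_add)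
  moreover have "Poly_Mapping.keys m \<subseteq> K" "Poly_Mapping.keys m' \<subseteq> K"
    by (auto simp: K_def)
  ultimately show ?thesis
    by (simp only: eq) (simp add: lookup_add power_add prod.distrib)
qed

lemma xsubst_single:
  assumes "h 0 = 0"
  shows "xsubst h a (Poly_Mapping.single m c) =
    h c * (\<Prod>i\<in>Poly_Mapping.keys m. a i ^ Poly_Mapping.lookup m i)"
  by (subst xsubst_eq_sum_superset[where K = "{m}"]) (use assms in auto)

lemma xsubst_1:
  assumes "h 0 = 0" "h 1 = 1"
  shows "xsubst h a 1 = 1"
  using xsubst_single[of h a 0 1] assms by simp

text \<open>Being a ring homomorphism is what lets evaluation pass through the operators, the
  derivative and the resultant.\<close>

lemma idom_hom_xsubst:
  fixes h :: "'a::idom \<Rightarrow> 'b::idom"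
  assumes "idom_hom h"
  shows "idom_hom (xsubst h a)"
proof -
  interpret h: idom_hom h by fact
  have add: "xsubst h a (p + q) = xsubst h a p + xsubst h a q" for p q
  proof -
    define K where "K = Poly_Mapping.keys p \<union> Poly_Mapping.keys q"
    have K: "finite K" "Poly_Mapping.keys p \<subseteq> K" "Poly_Mapping.keys q \<subseteq> K"
      "Poly_Mapping.keys (p + q) \<subseteq> K"
      using Poly_Mapping.keys_add[of p q] by (auto simp: K_def)
    show ?thesis
      using K by (simp add: xsubst_eq_sum_superset[where K = K] lookup_add h.hom_add
          distrib_right sum.distrib)
  qed
  have mult: "xsubst h a (p * q) = xsubst h a p * xsubst h a q" for p q
  proof (induction p rule: poly_mapping_add_single_induct)
    case (add_single p m c)
    have "xsubst h a (Poly_Mapping.single m c * q) =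
        xsubst h a (Poly_Mapping.single m c) * xsubst h a q"
    proof (induction q rule: poly_mapping_add_single_induct)
      case (add_single q m' c')
      then show ?case
        by (simp add: distrib_left add mult_single xsubst_single h.hom_mult monomial_eval_add mult_ac)
    qed simp
    with add_single.IH show ?case by (simp add: distrib_right add)
  qed simp
  show ?thesis
    by standard (auto simp: add mult xsubst_1)
qed

lemma xsubst_xconst: "h 0 = 0 \<Longrightarrow> xsubst h a (xconst c) = h c"
  by (simp add: xconst_def xsubst_single)

lemma xsubst_xvar: "h 0 = 0 \<Longrightarrow> h 1 = 1 \<Longrightarrow> xsubst h a (xvar i) = a i"
  by (simp add: xvar_def xsubst_single)

section \<open>Evaluating the N-path\<close>

text \<open>The operator 1 + c d/dt. With c from any domain it describes \<open>T_op\<close> itself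
  as well as its image under evaluation.\<close>

definition shift_op :: "'a::idom \<Rightarrow> 'a poly \<Rightarrow> 'a poly" where
  "shift_op c p = p + smult c (pderiv p)"

text \<open>Phrased by coefficients, so that every coefficient map sending 0 to 0 and 1 to 1
  preserves it.\<close>

definition monic_of_degree :: "nat \<Rightarrow> 'a::zero_neq_one poly \<Rightarrow> bool" where
  "monic_of_degree d p \<longleftrightarrow> coeff p d = 1 \<and> (\<forall>k>d. coeff p k = 0)"

lemma monic_of_degreeD:
  assumes "monic_of_degree d p"
  shows "degree p = d" "lead_coeff p = 1" "p \<noteq> 0"
proof -
  show deg: "degree p = d"
    using assms by (intro antisym degree_le le_degree) (auto simp: monic_of_degree_def)
  then show "lead_coeff p = 1" using assms by (simp add: monic_of_degree_def)
  then show "p \<noteq> 0" by auto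
qed

lemma monic_of_degree_shift_op: "monic_of_degree d p \<Longrightarrow> monic_of_degree d (shift_op c p)"
  by (simp add: monic_of_degree_def shift_op_def coeff_pderiv)

lemma monic_of_degree_map_poly:
  "monic_of_degree d p \<Longrightarrow> h 0 = 0 \<Longrightarrow> h 1 = 1 \<Longrightarrow> monic_of_degree d (map_poly h p)"
  by (simp add: monic_of_degree_def coeff_map_poly)

text \<open>Serves for monicity, for real-rootedness and, at s = 1, for equality with the starting
  polynomial.\<close>

lemma foldr_funpow_invariant:
  assumes "\<And>i p. P p \<Longrightarrow> P (f i p)" "P p"
  shows "P (foldr (\<lambda>i. f i ^^ d) is p)"
proof -
  have "P ((f i ^^ k) p)" if "P p" for i k p
    using that by (induction k) (auto intro: assms(1))
  with assms(2) show ?thesis by (induction "is") auto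
qed

lemma foldr_funpow_commute:
  assumes "\<And>i p. \<phi> (f i p) = g i (\<phi> p)"
  shows "\<phi> (foldr (\<lambda>i. f i ^^ d) is p) = foldr (\<lambda>i. g i ^^ d) is (\<phi> p)"
proof -
  have "\<phi> ((f i ^^ k) p) = (g i ^^ k) (\<phi> p)" for i k p
    by (induction k) (auto simp: assms)
  then show ?thesis by (induction "is") auto
qed

lemma T_op_eq_shift_op: "T_op s l = shift_op (xconst s * l)"
  by (simp add: T_op_def shift_op_def fun_eq_iff)

lemma (in idom_hom) map_poly_shift_op:
  "map_poly hom (shift_op c p) = shift_op (hom c) (map_poly hom p)"
  by (simp add: shift_op_def hom_distribs)

definition N_curve :: "nat \<Rightarrow> nat \<Rightarrow> real txpoly \<Rightarrow> (nat \<Rightarrow> real) \<Rightarrow> real \<Rightarrow> real poly" where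
  "N_curve n d F a s = map_poly (xsubst (\<lambda>c. poly c s) a) (N_path n d F)"

text \<open>Evaluation at (s,a) sends the factor (1 - s) x_i of each operator to (1 - s) a_i and
  turns G_s into the substitution of s a for x.\<close>

lemma N_curve_eq:
  "N_curve n d F a s = foldr (\<lambda>i. shift_op ((1 - s) * a i) ^^ d) [1..<Suc n]
     (map_poly (xsubst (\<lambda>c. c) (\<lambda>i. s * a i)) F)"
proof -
  define E where "E = xsubst (\<lambda>c. poly c s) a"
  interpret E: idom_hom E unfolding E_def by (intro idom_hom_xsubst poly_hom.idom_hom_axioms)
  have E_const: "E (xconst c) = poly c s" for c
    by (simp add: E_def xsubst_xconst)
  have E_var: "E (xvar i) = a i" for i
    by (simp add: E_def xsubst_xvar)
  have G: "E (xsubst xconst (\<lambda>i. xconst [:0, 1:] * xvar i) (Poly_Mapping.map (\<lambda>c. [:c:]) p)) =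
      xsubst (\<lambda>c. c) (\<lambda>i. s * a i) p" for p
  proof -
    have "Poly_Mapping.keys (Poly_Mapping.map (\<lambda>c. [:c:]) p) = Poly_Mapping.keys p"
      by (auto simp: in_keys_iff Poly_Mapping.map.rep_eq when_def)
    then show ?thesis
      unfolding xsubst_def E.hom_sum E.hom_mult E.hom_prod E.hom_power E_const E_var
      by (intro sum.cong) (auto simp: Poly_Mapping.map.rep_eq when_def in_keys_iff)
  qed
  have T: "map_poly E (T_op (1 - [:0, 1:]) (xvar i) p) =
      shift_op ((1 - s) * a i) (map_poly E p)" for i p
    by (simp add: T_op_eq_shift_op E.map_poly_shift_op E.hom_mult E_const E_var)
  have "map_poly E (G_op [:0, 1:] (map_poly (Poly_Mapping.map (\<lambda>c. [:c:])) F)) =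
      map_poly (xsubst (\<lambda>c. c) (\<lambda>i. s * a i)) F"
    unfolding G_op_def
    by (intro poly_eqI) (simp add: coeff_map_poly G[simplified] Poly_Mapping.map_eq_zero_iff)
  then show ?thesis
    unfolding N_curve_def E_def[symmetric] N_path_def N_op_def H_op_def
      foldr_funpow_commute[of "map_poly E" "\<lambda>i. T_op (1 - [:0, 1:]) (xvar i)", OF T]
    by simp
qed


section \<open>Monicity of the path and evaluation of its discriminant\<close>

lemma N_path_monic:
  assumes "monic_of_degree d F"
  shows "monic_of_degree d (N_path n d F)"
proof -
  have "Poly_Mapping.map (\<lambda>c::real. [:c:]) 1 = (1 :: real poly xpoly)"
    using Poly_Mapping.map_single[where f = "\<lambda>c::real. [:c:]" and x = "0 :: nat \<Rightarrow>\<^sub>0 nat" and c = 1] by simp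
  moreover have "Poly_Mapping.map (\<lambda>c::real. [:c:]) 0 = (0 :: real poly xpoly)"
    by (simp add: Poly_Mapping.map_eq_zero_iff)
  ultimately have "monic_of_degree d (map_poly (Poly_Mapping.map (\<lambda>c. [:c:])) F)"
    by (intro monic_of_degree_map_poly assms)
  then have G: "monic_of_degree d (G_op [:0, 1:] (map_poly (Poly_Mapping.map (\<lambda>c. [:c:])) F))"
    unfolding G_op_def by (rule monic_of_degree_map_poly) (simp_all add: xsubst_1 xconst_def)
  show ?thesis
    unfolding N_path_def N_op_def H_op_def T_op_eq_shift_op
    by (rule foldr_funpow_invariant[where P = "monic_of_degree d", OF _ G])
      (rule monic_of_degree_shift_op)
qed

text \<open>The resultant is a determinant whose size depends on the degrees of p and p', so both
  must survive \<open>h\<close>. In characteristic 0 the second degree is determined by the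
  first.\<close>

lemma idom_hom_monic_discriminant:
  fixes h :: "'a::{idom,ring_char_0} \<Rightarrow> 'b::{idom,ring_char_0}"
  assumes "idom_hom h" "degree (map_poly h p) = degree p"
  shows "h (monic_discriminant p) = monic_discriminant (map_poly h p)"
proof -
  interpret h: idom_hom h by fact
  have "degree (map_poly h (pderiv p)) = degree (pderiv p)"
    using assms by (simp add: h.map_poly_pderiv degree_pderiv)
  then have "h (resultant p (pderiv p)) = resultant (map_poly h p) (pderiv (map_poly h p))"
    using h.resultant_map_poly[of p "pderiv p"] assms by (simp add: h.map_poly_pderiv)
  then show ?thesis
    by (simp add: monic_discriminant_def h.hom_mult h.hom_power h.hom_uminus assms)
qed

lemma sx_eval_N_discriminant:
  assumes "monic_of_degree d F"
  shows "sx_eval (N_discriminant n d F) s a = monic_discriminant (N_curve n d F a s)"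
proof -
  note m = N_path_monic[OF assms, of n]
  have hom: "idom_hom (xsubst (\<lambda>c. poly c s) a)"
    by (intro idom_hom_xsubst poly_hom.idom_hom_axioms)
  interpret h: idom_hom "xsubst (\<lambda>c. poly c s) a" by fact
  have "degree (map_poly (xsubst (\<lambda>c. poly c s) a) (N_path n d F)) = degree (N_path n d F)"
    using monic_of_degreeD(1)[OF m] monic_of_degreeD(1)[OF monic_of_degree_map_poly[OF m]]
      h.hom_zero h.hom_one by metis
  then show ?thesis
    unfolding sx_eval_def N_discriminant_def N_curve_def
    by (intro idom_hom_monic_discriminant hom)
qed

lemma N_curve_monic:
  assumes "monic_of_degree d F"
  shows "monic_of_degree d (N_curve n d F a s)"
proof -
  interpret h: idom_hom "xsubst (\<lambda>c. poly c s) a"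
    by (intro idom_hom_xsubst poly_hom.idom_hom_axioms)
  show ?thesis
    unfolding N_curve_def by (intro monic_of_degree_map_poly N_path_monic assms) auto
qed

lemma continuous_on_coeff_N_curve:
  "continuous_on S (\<lambda>s. coeff (N_curve n d F a s) k)"
  by (simp add: N_curve_def coeff_map_poly) (auto simp: xsubst_def intro!: continuous_intros)

section \<open>Real-rooted polynomials\<close>

abbreviation cpoly :: "real poly \<Rightarrow> complex poly" where
  "cpoly \<equiv> map_poly complex_of_real"

text \<open>For real r the imaginary part of 1/(z - r) is -Im z / |z - r|^2. All terms have the same
  sign and cannot cancel.\<close>

lemma sum_inverse_diff_real:
  fixes R :: "complex multiset"
  assumes "\<And>r. r \<in># R \<Longrightarrow> r \<in> \<real>" "Im z \<noteq> 0" "R \<noteq> {#}"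
  shows "Im (\<Sum>r\<in>#R. inverse (z - r)) \<noteq> 0"
proof -
  have Im_eq: "Im (\<Sum>r\<in>#R. inverse (z - r)) = - Im z * (\<Sum>r\<in>#R. 1 / (cmod (z - r))\<^sup>2)"
    using assms(1)
    by (induction R) (auto simp: algebra_simps complex_is_Real_iff cmod_power2)
  have nz: "z - r \<noteq> 0" if "r \<in># R" for r
    using assms(1)[OF that] assms(2) by (auto simp: complex_is_Real_iff)
  have pos: "(\<Sum>r\<in>#R. 1 / (cmod (z - r))\<^sup>2) \<ge> 0" for R
    by (induction R) auto
  obtain r R' where R: "R = add_mset r R'"
    using assms(3) by (cases R) auto
  have "1 / (cmod (z - r))\<^sup>2 > 0" using nz[of r] R by simp
  from add_pos_nonneg[OF this pos[of R']] have "(\<Sum>r\<in>#R. 1 / (cmod (z - r))\<^sup>2) > 0"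
    by (simp only: R image_mset_add_mset sum_mset.add_mset)
  then show ?thesis using assms(2) unfolding Im_eq by (simp only: mult_eq_0_iff neg_equal_0_iff_equal) auto
qed

text \<open>The logarithmic derivative p'/p, cleared of its denominator; the multiset carries the
  multiplicities.\<close>

lemma poly_pderiv_prod_mset_linear:
  fixes z :: "'a::field"
  assumes "z \<notin># R"
  shows "poly (pderiv (\<Prod>r\<in>#R. [:- r, 1:])) z =
    poly (\<Prod>r\<in>#R. [:- r, 1:]) z * (\<Sum>r\<in>#R. inverse (z - r))"
  using assms
proof (induction R)
  case (add r R)
  define Q where "Q = (\<Prod>r\<in>#R. [:- r, 1:])"
  define S where "S = (\<Sum>r\<in>#R. inverse (z - r))"
  have IH: "poly (pderiv Q) z = poly Q z * S"
    using add by (simp add: Q_def S_def del: sum_mset_distrib_left)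
  have "pderiv ([:- r, 1:] * Q) = [:- r, 1:] * pderiv Q + Q"
    by (simp add: pderiv_mult pderiv_pCons del: mult_pCons_left)
  then have "poly (pderiv ([:- r, 1:] * Q)) z = poly ([:- r, 1:] * pderiv Q + Q) z"
    by (simp only:)
  also have "\<dots> = (z - r) * (poly Q z * S) + poly Q z"
    by (simp add: IH algebra_simps)
  also have "\<dots> = (z - r) * poly Q z * (inverse (z - r) + S)"
    using add.prems by (simp add: field_simps)
  also have "(z - r) * poly Q z = poly ([:- r, 1:] * Q) z"
    by (simp add: algebra_simps)
  finally show ?case
    by (simp only: image_mset_add_mset prod_mset.add_mset sum_mset.add_mset Q_def S_def)
qed auto

lemma cpoly_shift_op: "cpoly (shift_op c p) = shift_op (complex_of_real c) (cpoly p)"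
  by (rule of_real_hom.map_poly_shift_op)

text \<open>The zeros of \<open>p + c p'\<close> that are not zeros of \<open>p\<close> satisfy \<open>1 + c p'/p = 0\<close>, and off the
  real axis the imaginary part of \<open>p'/p = \<Sum> 1/(z - r)\<close> has the sign of \<open>- Im z\<close>.\<close>

lemma real_rooted_shift_op:
  assumes "real_rooted p" "p \<noteq> 0"
  shows "real_rooted (shift_op c p)"
  unfolding real_rooted_def
proof (intro allI impI, rule ccontr)
  fix z
  assume root: "poly (cpoly (shift_op c p)) z = 0" and "z \<notin> \<real>"
  then have z: "Im z \<noteq> 0" by (simp add: complex_is_Real_iff)
  define P where "P = cpoly p"
  define R where "R = proots P"
  define lc where "lc = lead_coeff P"
  have P0: "P \<noteq> 0" using assms by (simp add: P_def)
  then have R: "r \<in> \<real>" if "r \<in># R" for r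
    using that assms by (auto simp: R_def P_def real_rooted_def)
  then have zR: "z \<notin># R" using \<open>z \<notin> \<real>\<close> by auto
  have Pz: "poly P z \<noteq> 0" using zR P0 by (simp add: R_def)
  have P: "P = smult lc (\<Prod>r\<in>#R. [:- r, 1:])"
    unfolding lc_def R_def by (rule complex_poly_decompose_multiset[symmetric])
  define S where "S = (\<Sum>r\<in>#R. inverse (z - r))"
  have "poly (pderiv P) z = poly P z * S"
    unfolding S_def by (subst (1 2) P) (simp only: pderiv_smult poly_smult poly_pderiv_prod_mset_linear[OF zR] mult.assoc)
  then have "poly P z * (1 + complex_of_real c * S) = 0"
    using root unfolding cpoly_shift_op P_def[symmetric] by (simp add: shift_op_def algebra_simps)
  then have eq: "1 + complex_of_real c * S = 0"
    using Pz by simp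
  \<comment> \<open>An empty \<open>R\<close> or \<open>c = 0\<close> would turn the equation into 1
    = 0. Taking imaginary parts then removes the 1.\<close>
  then have "R \<noteq> {#}" "c \<noteq> 0" by (auto simp: S_def)
  moreover have "c * Im S = 0"
    using arg_cong[OF eq, of Im] by simp
  ultimately show False
    using sum_inverse_diff_real[of R z] R z by (simp add: S_def)
qed

text \<open>Each factor satisfies |z - r| >= |Im z| for real r, and there are d factors counted with
  multiplicity.\<close>

lemma real_rooted_monic_norm_bound:
  assumes "real_rooted p" "monic_of_degree d p"
  shows "\<bar>Im z\<bar> ^ d \<le> norm (poly (cpoly p) z)"
proof -
  define R where "R = proots (cpoly p)"
  note m = monic_of_degreeD[OF assms(2)]
  have R: "Im r = 0" if "r \<in># R" for r
    using that assms m by (auto simp: R_def real_rooted_def complex_is_Real_iff)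
  have "cpoly p = (\<Prod>r\<in>#R. [:- r, 1:])"
    using complex_poly_decompose_multiset[of "cpoly p"] m by (simp add: R_def)
  moreover have "\<bar>Im z\<bar> ^ size R \<le> norm (poly (\<Prod>r\<in>#R. [:- r, 1:]) z)"
    using R
  proof (induction R)
    case (add r R)
    have "\<bar>Im z\<bar> \<le> norm (z - r)"
      using abs_Im_le_cmod[of "z - r"] add.prems[of r] by simp
    with add show ?case
      by (auto simp: norm_mult simp del: mult_pCons_left intro!: mult_mono)
  qed auto
  moreover have "size R = d"
    using m by (simp add: R_def size_proots_complex)
  ultimately show ?thesis by simp
qed

section \<open>Discriminants of real polynomials\<close>

lemma of_real_monic_discriminant:
  "complex_of_real (monic_discriminant p) = monic_discriminant (cpoly p)"
  by (intro idom_hom_monic_discriminant) (auto intro: of_real_hom.idom_hom_axioms)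

text \<open>With real roots, the product of squared root differences consists of squares of reals.
  It is computed over the complex numbers and pulled back along the injective embedding of the
  reals.\<close>

lemma real_rooted_monic_discriminant_nonneg:
  assumes "real_rooted p" "lead_coeff p = 1"
  shows "monic_discriminant p \<ge> 0"
proof -
  obtain \<alpha> where \<alpha>: "smult (lead_coeff (cpoly p)) (\<Prod>i<degree (cpoly p). [:- \<alpha> i, 1:]) = cpoly p"
    using complex_poly_decompose' by blast
  then have p: "cpoly p = (\<Prod>i<degree p. [:- \<alpha> i, 1:])"
    using assms(2) by simp
  have real: "\<alpha> i = complex_of_real (Re (\<alpha> i))" if "i < degree p" for i
  proof -
    have "poly (cpoly p) (\<alpha> i) = 0"
      using that unfolding p by (auto simp: poly_prod)
    then show ?thesis
      using assms(1) by (simp add: real_rooted_def)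
  qed
  have "complex_of_real (monic_discriminant p) =
      (\<Prod>j<degree p. \<Prod>i<j. (\<alpha> i - \<alpha> j)\<^sup>2)"
    unfolding of_real_monic_discriminant p by (rule monic_discriminant_roots)
  also have "\<dots> = (\<Prod>j<degree p. \<Prod>i<j. complex_of_real ((Re (\<alpha> i) - Re (\<alpha> j))\<^sup>2))"
    by (intro prod.cong refl) (use real in simp)
  also have "\<dots> = complex_of_real (\<Prod>j<degree p. \<Prod>i<j. (Re (\<alpha> i) - Re (\<alpha> j))\<^sup>2)"
    by simp
  finally have "monic_discriminant p = (\<Prod>j<degree p. \<Prod>i<j. (Re (\<alpha> i) - Re (\<alpha> j))\<^sup>2)"
    by (simp only: of_real_eq_iff)
  then show ?thesis by (auto intro!: prod_nonneg)
qed

text \<open>A common root of p and p' makes the resultant vanish, by its product formula over the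
  roots of p.\<close>

lemma monic_discriminant_nonzero_imp_simple_root:
  assumes "p \<noteq> 0" "monic_discriminant p \<noteq> 0" "poly (cpoly p) z = 0"
  shows "poly (pderiv (cpoly p)) z \<noteq> 0"
proof
  assume deriv: "poly (pderiv (cpoly p)) z = 0"
  show False
  proof (cases "pderiv (cpoly p) = 0")
    \<comment> \<open>The product formula asks for a nonzero derivative; here \<open>p\<close> is a
      nonzero constant and has no root.\<close>
    case True
    then have "degree p = 0" by (simp add: pderiv_eq_0_iff)
    then obtain a where a: "p = [:a:]" by (rule degree_eq_zeroE)
    have "cpoly [:a:] = [:complex_of_real a:]"
      by (intro poly_eqI) (simp add: coeff_map_poly coeff_pCons split: nat.split)
    then show ?thesis using assms(1,3) a by simp
  next
    case False
    then have nz: "cpoly p \<noteq> 0" by auto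
    have "resultant (cpoly p) (pderiv (cpoly p)) = 0"
      unfolding resultant_roots[OF nz False]
      using assms(3) deriv nz by (auto simp: image_iff)
    then show ?thesis
      using assms(2) of_real_monic_discriminant[of p] by (simp add: monic_discriminant_def)
  qed
qed

section \<open>Real-rootedness along a path with nonvanishing discriminant\<close>

text \<open>\<open>D\<close> is the divided difference as an explicit polynomial, hence continuous
  up to the diagonal, where it becomes the derivative.\<close>

lemma poly_divided_difference:
  fixes a :: "nat \<Rightarrow> 'a::real_normed_field"
  assumes "n \<ge> 1"
  defines "D \<equiv> (\<lambda>z w. \<Sum>j<n. \<Sum>k<n-j. a (j + k + 1) * w ^ k * z ^ j)"
  shows "(\<Sum>i\<le>n. a i * z ^ i) - (\<Sum>i\<le>n. a i * w ^ i) = (z - w) * D z w"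
    and "((\<lambda>z. \<Sum>i\<le>n. a i * z ^ i) has_field_derivative D x x) (at x)"
proof -
  show diff: "(\<Sum>i\<le>n. a i * z ^ i) - (\<Sum>i\<le>n. a i * w ^ i) = (z - w) * D z w" for z w
    unfolding D_def by (rule polyfun_diff_alt[OF assms(1)])
  have "isCont (\<lambda>z. D z x) x"
    unfolding D_def by (intro continuous_intros)
  then show "((\<lambda>z. \<Sum>i\<le>n. a i * z ^ i) has_field_derivative D x x) (at x)"
    unfolding CARAT_DERIV by (intro exI[of _ "\<lambda>z. D z x"]) (simp add: diff mult.commute)
qed

text \<open>The abstract setting of the path argument, applied later to \<open>N_curve\<close> at
  each fixed nonzero a.\<close>

locale simple_root_path =
  fixes d :: nat and q :: "real \<Rightarrow> real poly"
  assumes d: "d \<ge> 1"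
    and monic: "\<And>s. s \<in> {0..1} \<Longrightarrow> monic_of_degree d (q s)"
    and cont: "\<And>k. continuous_on {0..1} (\<lambda>s. coeff (q s) k)"
    and disc: "\<And>s. s \<in> {0..1} \<Longrightarrow> monic_discriminant (q s) \<noteq> 0"
begin

text \<open>Summing up to the fixed bound d makes joint continuity in s and z visible; agreement
  with \<open>q s\<close> is claimed for s in [0,1].\<close>

definition value_at :: "real \<Rightarrow> complex \<Rightarrow> complex" where
  "value_at s z = (\<Sum>i\<le>d. complex_of_real (coeff (q s) i) * z ^ i)"

definition divided_difference :: "real \<Rightarrow> complex \<Rightarrow> complex \<Rightarrow> complex" where
  "divided_difference s z w =
     (\<Sum>j<d. \<Sum>k<d-j. complex_of_real (coeff (q s) (j + k + 1)) * w ^ k * z ^ j)"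

lemma poly_cpoly_q: "s \<in> {0..1} \<Longrightarrow> poly (cpoly (q s)) z = value_at s z"
  using monic_of_degreeD(1)[OF monic, of s] by (simp add: poly_altdef value_at_def)

lemma closed_real_rooted: "closed {s \<in> {0..1}. real_rooted (q s)}"
proof -
  have "real_rooted (q s) \<longleftrightarrow> (\<forall>z. \<bar>Im z\<bar> ^ d \<le> norm (value_at s z))" if s: "s \<in> {0..1}" for s
  proof
    assume "real_rooted (q s)"
    then show "\<forall>z. \<bar>Im z\<bar> ^ d \<le> norm (value_at s z)"
      using real_rooted_monic_norm_bound[OF _ monic[OF s]] poly_cpoly_q[OF s] by simp
  next
    assume *: "\<forall>z. \<bar>Im z\<bar> ^ d \<le> norm (value_at s z)"
    show "real_rooted (q s)"
      unfolding real_rooted_def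
    proof (intro allI impI)
      fix z assume "poly (cpoly (q s)) z = 0"
      then have "\<bar>Im z\<bar> ^ d \<le> 0" using *[rule_format, of z] poly_cpoly_q[OF s] by simp
      then have "Im z = 0"
        by (metis abs_ge_zero abs_eq_0 antisym power_eq_0_iff zero_le_power)
      then show "z \<in> \<real>" by (simp add: complex_is_Real_iff)
    qed
  qed
  then have "{s \<in> {0..1}. real_rooted (q s)} =
      (\<Inter>z. {s \<in> {0..1}. norm (value_at s z) \<in> {\<bar>Im z\<bar> ^ d..}})"
    by auto
  also have "closed \<dots>"
    unfolding value_at_def
    by (intro closed_INT ballI continuous_closed_preimage[unfolded vimage_def Int_def mem_Collect_eq]
        continuous_intros cont closed_atLeastAtMost closed_atLeast)
  finally show ?thesis .
qed

text \<open>Outside the unit disk every lower power of |z| is at most |z|^(d - 1), so a root there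
  is bounded by the sum of the absolute values of the lower coefficients. This continuous function
  of s attains a maximum on [0,1].\<close>

lemma roots_bounded:
  obtains B where "\<And>s z. s \<in> {0..1} \<Longrightarrow> value_at s z = 0 \<Longrightarrow> norm z \<le> B"
proof -
  define c where "c s = (\<Sum>i<d. \<bar>coeff (q s) i\<bar>)" for s
  have "continuous_on {0..1} c" unfolding c_def by (intro continuous_intros cont)
  then obtain s0 where s0: "\<forall>s\<in>{0..1}. c s \<le> c s0"
    using continuous_attains_sup[of "{0..1::real}" c] by auto
  have "norm z \<le> max 1 (c s0)" if s: "s \<in> {0..1}" and z: "value_at s z = 0" for s z
  proof (cases "norm z \<le> 1")
    case False
    obtain e where e: "d = Suc e" using d by (cases d) auto
    have "z ^ d + (\<Sum>i<d. complex_of_real (coeff (q s) i) * z ^ i) = 0"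
      using z monic[OF s] by (simp add: add.commute value_at_def monic_of_degree_def flip: lessThan_Suc_atMost)
    then have "z ^ d = - (\<Sum>i<d. complex_of_real (coeff (q s) i) * z ^ i)"
      by (simp add: eq_neg_iff_add_eq_0)
    then have "norm z ^ d = norm (\<Sum>i<d. complex_of_real (coeff (q s) i) * z ^ i)"
      by (metis norm_minus_cancel norm_power)
    also have "\<dots> \<le> (\<Sum>i<d. norm (complex_of_real (coeff (q s) i) * z ^ i))"
      by (rule norm_sum)
    also have "\<dots> \<le> (\<Sum>i<d. \<bar>coeff (q s) i\<bar> * norm z ^ e)"
      using False e by (intro sum_mono) (auto simp: norm_mult norm_power intro!: mult_left_mono power_increasing)
    also have "\<dots> = c s * norm z ^ e" by (simp add: c_def sum_distrib_right)
    finally have "norm z * norm z ^ e \<le> c s * norm z ^ e" by (simp add: e)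
    moreover have "norm z ^ e > 0" using False by (intro zero_less_power) linarith
    ultimately have "norm z \<le> c s" by simp
    then show ?thesis using s0 s by fastforce
  qed simp
  then show ?thesis using that by blast
qed

text \<open>Since all roots are simple, the vanishing of the divided difference at \<open>z\<close>, \<open>cnj z\<close> singles
  out the nonreal roots by equations, so they form a compact set.\<close>

lemma closed_not_real_rooted: "closed {s \<in> {0..1}. \<not> real_rooted (q s)}"
proof -
  define K where
    "K = {(s, z). s \<in> {0..1} \<and> value_at s z = 0 \<and> divided_difference s z (cnj z) = 0}"
  have K_iff: "(s, z) \<in> K \<longleftrightarrow> value_at s z = 0 \<and> z \<notin> \<real>" if s: "s \<in> {0..1}" for s z
  proof (cases "value_at s z = 0")
    case root: True
    have diff: "value_at s z - value_at s w = (z - w) * divided_difference s z w" for w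
      unfolding value_at_def divided_difference_def by (rule poly_divided_difference(1)[OF d])
    have "value_at s (cnj z) = cnj (value_at s z)"
      by (simp add: value_at_def)
    \<comment> \<open>Real coefficients make \<open>cnj z\<close> a root too, so a nonreal root
      annihilates the divided difference.\<close>
    then have prod: "(z - cnj z) * divided_difference s z (cnj z) = 0"
      using root diff[of "cnj z"] by simp
    have "(value_at s has_field_derivative divided_difference s z z) (at z)"
      unfolding value_at_def divided_difference_def by (rule poly_divided_difference(2)[OF d])
    moreover have "(value_at s has_field_derivative poly (pderiv (cpoly (q s))) z) (at z)"
      using poly_DERIV[of "cpoly (q s)" z] poly_cpoly_q[OF s] by simp
    ultimately have "divided_difference s z z = poly (pderiv (cpoly (q s))) z"
      by (rule DERIV_unique)
    \<comment> \<open>For real z the points z and \<open>cnj z\<close> coincide and the divided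
      difference is the derivative, nonzero at a simple root. Thus real roots stay outside
      \<open>K\<close>.\<close>
    then have "divided_difference s z z \<noteq> 0"
      using monic_discriminant_nonzero_imp_simple_root[OF _ disc[OF s]] root monic_of_degreeD(3)[OF monic[OF s]] poly_cpoly_q[OF s] by simp
    then show ?thesis
      using s root prod by (auto simp: K_def Reals_cnj_iff)
  qed (auto simp: K_def)
  have "{s \<in> {0..1}. \<not> real_rooted (q s)} = fst ` K"
  proof (intro equalityI subsetI)
    fix s assume "s \<in> {s \<in> {0..1}. \<not> real_rooted (q s)}"
    then obtain z where "s \<in> {0..1}" "poly (cpoly (q s)) z = 0" "z \<notin> \<real>"
      by (auto simp: real_rooted_def)
    then have "(s, z) \<in> K" using K_iff poly_cpoly_q by simp
    then show "s \<in> fst ` K" by force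
  next
    fix s assume "s \<in> fst ` K"
    then obtain z where z: "(s, z) \<in> K" by auto
    then have s: "s \<in> {0..1}" by (simp add: K_def)
    then show "s \<in> {s \<in> {0..1}. \<not> real_rooted (q s)}"
      using z K_iff[OF s] poly_cpoly_q[OF s] by (auto simp: real_rooted_def)
  qed
  \<comment> \<open>Compactness, unlike closedness, survives the projection \<open>fst\<close>; it
    comes from the root bound, which is uniform in s.\<close>
  moreover have "compact K"
  proof -
    obtain B where B: "\<And>s z. s \<in> {0..1} \<Longrightarrow> value_at s z = 0 \<Longrightarrow> norm z \<le> B"
      using roots_bounded by blast
    define C where "C = {0..1::real} \<times> cball (0::complex) B"
    have C: "compact C" unfolding C_def by (intro compact_Times) auto
    have cont': "continuous_on C (\<lambda>x. coeff (q (fst x)) k)" for k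
      by (rule continuous_on_compose2[OF cont continuous_on_fst]) (auto simp: C_def intro!: continuous_intros)
    have eq: "K = C \<inter> (\<lambda>x. (value_at (fst x) (snd x),
        divided_difference (fst x) (snd x) (cnj (snd x)))) -` {(0, 0)}"
      using B by (auto simp: K_def C_def)
    have "closed K"
      unfolding eq value_at_def divided_difference_def
      by (intro continuous_closed_preimage continuous_intros cont' compact_imp_closed C) auto
    then have "compact (C \<inter> K)" using C by (rule compact_Int_closed[rotated])
    moreover have "C \<inter> K = K" using eq by auto
    ultimately show ?thesis by simp
  qed
  ultimately show ?thesis
    by (auto intro!: compact_imp_closed compact_continuous_image continuous_intros)
qed

text \<open>The connected interval [0,1] is a disjoint union of two closed sets, so one of them is
  empty.\<close>

lemma real_rooted_transfer:
  assumes "real_rooted (q 0)"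
  shows "real_rooted (q 1)"
proof (rule ccontr)
  assume "\<not> real_rooted (q 1)"
  moreover have "{s \<in> {0..1}. real_rooted (q s)} \<inter> {0..1} = {} \<or>
      {s \<in> {0..1}. \<not> real_rooted (q s)} \<inter> {0..1} = {}"
    by (intro connected_closedD closed_real_rooted closed_not_real_rooted) auto
  ultimately show False
    using assms by (auto simp: disjoint_iff)
qed

end

section \<open>Forms\<close>

lemma txform_keys:
  assumes "txform n d F" "m \<in> Poly_Mapping.keys (coeff F k)"
  shows "Poly_Mapping.keys m \<subseteq> {1..n}"
    and "k + (\<Sum>i\<in>Poly_Mapping.keys m. Poly_Mapping.lookup m i) = d"
  using assms unfolding txform_def by blast+

text \<open>At x = 0 only the constant monomial survives, and homogeneity confines it to the
  coefficient of t^d. Serves both at e and at the start s = 0 of the path.\<close>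

lemma txform_map_poly_xsubst_zero:
  fixes b :: "nat \<Rightarrow> 'a::comm_ring_1"
  assumes F: "txform n d F" and b: "\<And>i. i \<in> {1..n} \<Longrightarrow> b i = 0"
  shows "map_poly (xsubst (\<lambda>c. c) b) F = monom (Poly_Mapping.lookup (coeff F d) 0) d"
proof (intro poly_eqI)
  fix k
  have summand: "(\<Prod>i\<in>Poly_Mapping.keys m. b i ^ Poly_Mapping.lookup m i) = 0"
    if m: "m \<in> Poly_Mapping.keys (coeff F k)" "m \<noteq> 0" for m
  proof -
    from m(2) obtain i where i: "i \<in> Poly_Mapping.keys m"
      by (metis keys_eq_empty ex_in_conv)
    with b txform_keys(1)[OF F m(1)] have "b i = 0" by blast
    moreover have "Poly_Mapping.lookup m i > 0" using i by (simp add: in_keys_iff)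
    ultimately have "b i ^ Poly_Mapping.lookup m i = 0"
      by (simp add: zero_power)
    with i show ?thesis by (intro prod_zero) auto
  qed
  have "xsubst (\<lambda>c. c) b (coeff F k) = Poly_Mapping.lookup (coeff F k) 0"
  proof -
    have "xsubst (\<lambda>c. c) b (coeff F k) =
        (\<Sum>m\<in>Poly_Mapping.keys (coeff F k). if m = 0 then Poly_Mapping.lookup (coeff F k) 0 else 0)"
      unfolding xsubst_def using summand by (intro sum.cong) auto
    then show ?thesis by (simp add: in_keys_iff)
  qed
  moreover have "Poly_Mapping.lookup (coeff F k) 0 = 0" if "k \<noteq> d"
    using txform_keys(2)[OF F, of 0 k] that by (auto simp: in_keys_iff)
  ultimately show "coeff (map_poly (xsubst (\<lambda>c. c) b) F) k =
      coeff (monom (Poly_Mapping.lookup (coeff F d) 0) d) k"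
    by (cases "k = d") (simp_all add: coeff_map_poly)
qed

text \<open>Homogeneity leaves only a constant in the coefficient of t^d and nothing above it; the
  value at e shows that the constant is 1.\<close>

lemma txform_monic:
  fixes F :: "real txpoly"
  assumes F: "txform n d F" and e: "txsubst (\<lambda>c. c) tdir F = 1"
  shows "monic_of_degree d F"
proof -
  have "Poly_Mapping.lookup (coeff F d) 0 = 1"
    using e unfolding txsubst_def
    by (subst (asm) txform_map_poly_xsubst_zero[OF F]) (auto simp: tdir_def poly_monom)
  moreover have "m = 0" if "m \<in> Poly_Mapping.keys (coeff F d)" for m
  proof -
    have "(\<Sum>i\<in>Poly_Mapping.keys m. Poly_Mapping.lookup m i) = 0"
      using txform_keys(2)[OF F that] by simp
    then have "\<forall>i\<in>Poly_Mapping.keys m. Poly_Mapping.lookup m i = 0"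
      by (simp add: sum_eq_0_iff)
    then have "Poly_Mapping.keys m = {}"
      unfolding in_keys_iff by blast
    then show ?thesis by simp
  qed
  ultimately have "coeff F d = Poly_Mapping.single 0 1"
    by (intro poly_mapping_eqI) (auto simp: lookup_single when_def in_keys_iff simp del: single_one)
  moreover have "coeff F k = 0" if "k > d" for k
  proof -
    have "Poly_Mapping.keys (coeff F k) = {}"
      using txform_keys(2)[OF F, of _ k] that by fastforce
    then show ?thesis by simp
  qed
  ultimately show ?thesis by (simp add: monic_of_degree_def)
qed

text \<open>For b = (0,-a) the point u e - b is (u,a), which is how hyperbolicity speaks about
  F(t,a).\<close>

lemma txform_line_poly:
  assumes F: "txform n d F"
  shows "line_poly F tdir (\<lambda>i. if i = 0 then 0 else - a i) = map_poly (xsubst (\<lambda>c. c) a) F"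
proof -
  define b where "b = (\<lambda>i. [:- (if i = 0 then 0 else - a i), tdir i:])"
  have "xsubst (\<lambda>c. [:c:]) b (coeff F k) = [:xsubst (\<lambda>c. c) a (coeff F k):]" for k
    unfolding xsubst_def coeff_lift_hom.hom_sum coeff_lift_hom.hom_mult coeff_lift_hom.hom_prod coeff_lift_hom.hom_power
  proof (intro sum.cong arg_cong2[of _ _ _ _ "(*)"] prod.cong refl)
    fix m i
    assume "m \<in> Poly_Mapping.keys (coeff F k)" "i \<in> Poly_Mapping.keys m"
    \<comment> \<open>The entry \<open>b 0\<close> is the indeterminate u, while all others are
      constants; monomials in x avoid index 0.\<close>
    then have "i \<noteq> 0" using txform_keys(1)[OF F] by fastforce
    then show "b i ^ Poly_Mapping.lookup m i = [:a i:] ^ Poly_Mapping.lookup m i"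
      by (simp add: b_def tdir_def)
  qed
  then have "map_poly (xsubst (\<lambda>c. [:c:]) b) F =
      map_poly (\<lambda>c. [:c:]) (map_poly (xsubst (\<lambda>c. c) a) F)"
    by (intro poly_eqI) (simp add: coeff_map_poly)
  then show ?thesis
    unfolding line_poly_def txsubst_def b_def[symmetric]
    by (simp add: b_def tdir_def pcompose_idR[simplified] flip: pcompose_altdef)
qed

section \<open>Endpoints of the path and the two implications\<close>

lemma real_rooted_N_curve:
  assumes "monic_of_degree d F" "real_rooted (map_poly (xsubst (\<lambda>c. c) (\<lambda>i. s * a i)) F)"
  shows "real_rooted (N_curve n d F a s)"
proof -
  have base: "monic_of_degree d (map_poly (xsubst (\<lambda>c. c) (\<lambda>i. s * a i)) F)"
    using assms(1) by (rule monic_of_degree_map_poly) (simp_all add: xsubst_1)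
  \<comment> \<open>Monicity is carried along because \<open>real_rooted_shift_op\<close> asks for a
    nonzero polynomial.\<close>
  have "real_rooted (N_curve n d F a s) \<and> monic_of_degree d (N_curve n d F a s)"
    unfolding N_curve_eq
    by (rule foldr_funpow_invariant[where P = "\<lambda>p. real_rooted p \<and> monic_of_degree d p",
          OF _ conjI[OF assms(2) base]])
      (auto intro: real_rooted_shift_op monic_of_degree_shift_op dest: monic_of_degreeD(3))
  then show ?thesis by simp
qed

text \<open>At s = 1 every parameter (1 - s) a_i is 0, so each operator is the identity.\<close>

lemma N_curve_1: "N_curve n d F a 1 = map_poly (xsubst (\<lambda>c. c) a) F"
  unfolding N_curve_eq
  by (rule foldr_funpow_invariant[where P = "\<lambda>p. p = map_poly (xsubst (\<lambda>c. c) a) F"])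
    (simp_all add: shift_op_def)

lemma real_rooted_monom: "real_rooted (monom 1 d)"
  by (auto simp: real_rooted_def map_poly_monom poly_monom)

lemma real_distinct_rootedI:
  assumes "real_rooted p" "p \<noteq> 0" "monic_discriminant p \<noteq> 0"
  shows "real_distinct_rooted p"
  unfolding real_distinct_rooted_def
proof (intro allI impI conjI)
  fix z assume root: "poly (cpoly p) z = 0"
  then show "z \<in> \<real>" using assms(1) by (simp add: real_rooted_def)
  have deriv: "poly (pderiv (cpoly p)) z \<noteq> 0"
    using monic_discriminant_nonzero_imp_simple_root[OF assms(2,3) root] .
  then have "pderiv (cpoly p) \<noteq> 0" by auto
  moreover have "order z (cpoly p) \<noteq> 0"
    using root assms(2) order_root[of "cpoly p" z] by simp
  moreover have "order z (pderiv (cpoly p)) = 0"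
    using deriv by (simp add: order_root)
  ultimately show "order z (cpoly p) = 1"
    using order_pderiv[of "cpoly p" z] root assms(2) by auto
qed

theorem theorem4p4:
  fixes n d :: nat and F :: "real txpoly"
  assumes "n \<ge> 1" and "d \<ge> 1"
    and "txform n d F"
    and "txsubst (\<lambda>c. c) tdir F = 1"
  shows "(hyperbolic F tdir \<longrightarrow>
           (\<forall>s\<in>{0..1}. \<forall>a. sx_eval (N_discriminant n d F) s a \<ge> 0)) \<and>
         ((\<forall>s\<in>{0..1}. \<forall>a. (\<exists>i\<in>{1..n}. a i \<noteq> 0) \<longrightarrow> sx_eval (N_discriminant n d F) s a > 0) \<longrightarrow>
           strictly_hyperbolic_tdir n F)"
proof (intro conjI impI ballI allI)
  note F_monic = txform_monic[OF assms(3,4)]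
  note disc = sx_eval_N_discriminant[OF F_monic, of n]
  show "sx_eval (N_discriminant n d F) s a \<ge> 0" if "hyperbolic F tdir" for s a
  proof -
    have "real_rooted (map_poly (xsubst (\<lambda>c. c) (\<lambda>i. s * a i)) F)"
      using that unfolding hyperbolic_def txform_line_poly[OF assms(3), symmetric] by blast
    then show ?thesis
      unfolding disc
      by (intro real_rooted_monic_discriminant_nonneg real_rooted_N_curve F_monic
          monic_of_degreeD(2)[OF N_curve_monic[OF F_monic]])
  qed
  assume pos: "\<forall>s\<in>{0..1}. \<forall>a. (\<exists>i\<in>{1..n}. a i \<noteq> 0) \<longrightarrow> sx_eval (N_discriminant n d F) s a > 0"
  show "strictly_hyperbolic_tdir n F"
    unfolding strictly_hyperbolic_tdir_def
  proof (intro conjI allI impI)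
    show "txsubst (\<lambda>c. c) tdir F \<noteq> 0" using assms(4) by simp
    fix a :: "nat \<Rightarrow> real" assume a: "\<exists>i\<in>{1..n}. a i \<noteq> 0"
    have disc_pos: "monic_discriminant (N_curve n d F a s) > 0" if "s \<in> {0..1}" for s
      using pos a that unfolding disc by blast
    interpret simple_root_path d "N_curve n d F a"
    proof
      show "monic_discriminant (N_curve n d F a s) \<noteq> 0" if "s \<in> {0..1}" for s
        using disc_pos[OF that] by simp
    qed (intro assms(2) N_curve_monic F_monic continuous_on_coeff_N_curve)+
    \<comment> \<open>At s = 0 all x-coordinates vanish, so the operators act on t^d, which is
      real-rooted.\<close>
    have "map_poly (xsubst (\<lambda>c. c) (\<lambda>i. 0 * a i)) F = monom 1 d"
      using txform_map_poly_xsubst_zero[OF assms(3), of "\<lambda>i. 0 * a i"] F_monic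
      by (simp add: monic_of_degree_def[of d F])
    then have "real_rooted (N_curve n d F a 0)"
      using real_rooted_monom by (intro real_rooted_N_curve F_monic) simp
    then have "real_rooted (N_curve n d F a 1)" by (rule real_rooted_transfer)
    \<comment> \<open>Positivity of the discriminant at s = 1 itself upgrades real roots to distinct
      ones.\<close>
    then have "real_distinct_rooted (N_curve n d F a 1)"
      using monic_of_degreeD(3)[OF N_curve_monic[OF F_monic]] disc_pos[of 1]
      by (intro real_distinct_rootedI) auto
    then show "real_distinct_rooted (map_poly (xsubst (\<lambda>c. c) a) F)"
      by (simp only: N_curve_1)
  qed
qed

end
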